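(* Let $(u_n)_{n\ge 1}$ be the sequence defined by $u_1 = u_2 = u_3 = 1$ and $u_n = u_{n-1} + u_{n-2} + u_{n-3}$ for $n \ge 4$. Let $q_1, q_2, q_3$ be the three complex roots of the equation $q^3 - q^2 - q - 1 = 0$, and put $$c_1 = \frac{(1-q_3)(1-q_2)}{(q_3-q_1)(q_2-q_1)}, \qquad c_2 = \frac{(1-q_1)(q_3-1)}{(q_2-q_1)(q_3-q_2)}, \qquad c_3 = \frac{(1-q_1)(1-q_2)}{(q_3-q_1)(q_3-q_2)}.$$ Then for every integer $n \ge 1$, $$u_n = c_1 q_1^{n-1} + c_2 q_2^{n-1} + c_3 q_3^{n-1}.$$
   Context: The sequence $(u_n)$ is called the sequence of pseudo-Fibonacci numbers of order 3. *)

theory Defs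
  imports Complex_Main
begin

end

theory Submission
  imports Defs "HOL-Computational_Algebra.Fundamental_Theorem_Algebra"
begin

text \<open>
  The coefficients $c_i$ are the values at $1$ of the Lagrange basis polynomials with nodes
  $q_1, q_2, q_3$. Interpolating the monomials $1$, $x$, $x^2$ therefore gives
  $c_1 q_1^k + c_2 q_2^k + c_3 q_3^k = 1^k = 1$ for $k = 0, 1, 2$, which are the initial values,
  and each $q_i^k$ satisfies the recurrence. The nodes are distinct because the characteristic
  polynomial has no root in common with its derivative $(3x + 1)(x - 1)$.
\<close>

text \<open>The main theorem only names the root set as \<open>{q1, q2, q3}\<close>; cardinality 3
  is what makes these three numbers pairwise distinct.\<close>

lemma card_tribonacci_roots:
  "card {q :: complex. q ^ 3 - q ^ 2 - q - 1 = 0} = 3"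
proof -
  define p :: "complex poly" where "p = [:-1, -1, -1, 1:]"
  have poly_p: "poly p q = q ^ 3 - q ^ 2 - q - 1" for q
    by (simp add: p_def power2_eq_square power3_eq_cube algebra_simps)
  have poly_p': "poly (pderiv p) q = (3 * q + 1) * (q - 1)" for q
    by (simp add: p_def pderiv_pCons algebra_simps)
  have "\<not> (poly p q = 0 \<and> poly (pderiv p) q = 0)" for q
  proof
    assume *: "poly p q = 0 \<and> poly (pderiv p) q = 0"
    then have "3 * q = -1 \<or> q = 1"
      by (simp add: poly_p' eq_neg_iff_add_eq_0)
    then have "q = -1/3 \<or> q = 1"
      by (auto simp: field_simps)
    \<comment> \<open>The values of \<open>p\<close> at -1/3 and 1 are -22/27 and -2.\<close>
    then show False
      using * by (auto simp: poly_p power2_eq_square power3_eq_cube)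
  qed
  then have "rsquarefree p"
    by (simp add: rsquarefree_roots)
  moreover have "p \<noteq> 0" "degree p = 3"
    by (simp_all add: p_def)
  \<comment> \<open>Being squarefree, \<open>p\<close> is a scalar multiple of the product of one
    linear factor per distinct root, so its degree counts its roots.\<close>
  ultimately have "degree (\<Prod>z | poly p z = 0. [:-z, 1:]) = 3"
    using complex_poly_decompose_rsquarefree[of p] by (metis degree_smult_eq leading_coeff_0_iff)
  then show ?thesis
    by (simp add: degree_prod_eq_sum_degree poly_p)
qed

text \<open>Interpolation at three nodes is exact up to degree 2, hence the bound on
  \<open>k\<close>. In the middle coefficient both factors involving \<open>z\<close> have the
  opposite sign to the usual Lagrange form, which cancels.\<close>

lemma lagrange_quadratic_at_1:
  fixes x y z :: "'a :: field"
  assumes "x \<noteq> y" "x \<noteq> z" "y \<noteq> z" and "k \<le> 2"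
  shows "(1 - z) * (1 - y) / ((z - x) * (y - x)) * x ^ k
       + (1 - x) * (z - 1) / ((y - x) * (z - y)) * y ^ k
       + (1 - x) * (1 - y) / ((z - x) * (z - y)) * z ^ k = 1"
proof -
  have nz: "y - x \<noteq> 0" "z - x \<noteq> 0" "z - y \<noteq> 0"
    using assms by auto
  \<comment> \<open>The Vandermonde determinant of the nodes is a common denominator; clearing it
    leaves a polynomial identity for each of the three exponents.\<close>
  define d where "d = (y - x) * (z - x) * (z - y)"
  have "d \<noteq> 0"
    using nz by (simp add: d_def)
  have eqs: "(1 - z) * (1 - y) / ((z - x) * (y - x)) = (1 - z) * (1 - y) * (z - y) / d"
    "(1 - x) * (z - 1) / ((y - x) * (z - y)) = (1 - x) * (z - 1) * (z - x) / d"
    "(1 - x) * (1 - y) / ((z - x) * (z - y)) = (1 - x) * (1 - y) * (y - x) / d"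
    using nz by (simp_all add: d_def)
  have "(1 - z) * (1 - y) * (z - y) * x ^ k + (1 - x) * (z - 1) * (z - x) * y ^ k
      + (1 - x) * (1 - y) * (y - x) * z ^ k = d"
  proof -
    have "k = 0 \<or> k = 1 \<or> k = 2"
      using \<open>k \<le> 2\<close> by auto
    then show ?thesis
      unfolding d_def by (elim disjE) (simp_all add: power2_eq_square algebra_simps)
  qed
  then show ?thesis
    unfolding eqs using \<open>d \<noteq> 0\<close> by (simp add: add_divide_distrib[symmetric])
qed

theorem mainTheorem19:
  fixes u :: "nat \<Rightarrow> nat"
    and q1 q2 q3 c1 c2 c3 :: complex
  assumes u_init: "u 1 = 1" "u 2 = 1" "u 3 = 1"
    and u_rec: "\<forall>n\<ge>4. u n = u (n - 1) + u (n - 2) + u (n - 3)"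
    and roots: "{q :: complex. q ^ 3 - q ^ 2 - q - 1 = 0} = {q1, q2, q3}"
    and c1: "c1 = ((1 - q3) * (1 - q2)) / ((q3 - q1) * (q2 - q1))"
    and c2: "c2 = ((1 - q1) * (q3 - 1)) / ((q2 - q1) * (q3 - q2))"
    and c3: "c3 = ((1 - q1) * (1 - q2)) / ((q3 - q1) * (q3 - q2))"
  shows "\<forall>n\<ge>1. of_nat (u n) = c1 * q1 ^ (n - 1) + c2 * q2 ^ (n - 1) + c3 * q3 ^ (n - 1)"
proof -
  have "card {q1, q2, q3} = 3"
    using card_tribonacci_roots by (simp only: roots)
  then have distinct: "q1 \<noteq> q2" "q1 \<noteq> q3" "q2 \<noteq> q3"
    by (auto simp: card_insert_if split: if_splits)
  \<comment> \<open>Indexing from 0 matches \<open>f k\<close> with \<open>u (k + 1)\<close> and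
    avoids truncated subtraction in the exponents.\<close>
  define f where "f k = c1 * q1 ^ k + c2 * q2 ^ k + c3 * q3 ^ k" for k
  have f_init: "f k = 1" if "k \<le> 2" for k
    unfolding f_def c1 c2 c3 using lagrange_quadratic_at_1[OF distinct that] .
  have pow_rec: "q ^ (k + 3) = q ^ (k + 2) + q ^ (k + 1) + q ^ k" if "q \<in> {q1, q2, q3}" for q k
  proof -
    have "q ^ 3 - q ^ 2 - q - 1 = 0"
      using that roots by blast
    then have "q ^ 3 = q ^ 2 + q + 1"
      by (simp add: algebra_simps)
    then show ?thesis
      by (simp add: power_add algebra_simps power2_eq_square)
  qed
  have f_rec: "f (k + 3) = f (k + 2) + f (k + 1) + f k" for k
    unfolding f_def by (simp add: pow_rec del: power_Suc add_Suc_right) (simp add: algebra_simps)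
  have "of_nat (u (k + 1)) = f k" for k
  proof (induction k rule: less_induct)
    case (less k)
    show ?case
    proof (cases "k \<le> 2")
      case True
      then have "k = 0 \<or> k = 1 \<or> k = 2"
        by auto
      then have "u (k + 1) = 1"
        using u_init by (auto simp: numeral_eq_Suc)
      then show ?thesis
        using f_init[OF True] by simp
    next
      case False
      define m where "m = k - 3"
      have k: "k = m + 3"
        using False by (simp add: m_def)
      \<comment> \<open>The index \<open>m + 4\<close> is at least 4, so the recurrence applies
        there.\<close>
      have "u (m + 3 + 1) = u (m + 2 + 1) + u (m + 1 + 1) + u (m + 1)"
        using u_rec[rule_format, of "m + 4"] by (simp add: numeral_eq_Suc)
      then show ?thesis
        using less.IH[of "m + 2"] less.IH[of "m + 1"] less.IH[of m] by (simp add: k f_rec)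
    qed
  qed
  then show ?thesis
    unfolding f_def by (metis le_add_diff_inverse2)
qed

end
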